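(* Let $D$ be a finite set, $M=\mathrm{QoI}(D)$ with greatest element $\top$, $\sigma:\mathit{Var}\to M_1$, and let $u,w,v_0\in\mathit{Var}$ be distinct. Suppose $\sigma(v_0)$ is saturated, i.e. $\sigma(v_0)\otimes\sigma(v_0)=\top$. Let $C_3=(u:=v_0;\;w:=v_0)$ and consider the policy $(\sigma,\{u,w\},\sigma(v_0))$. Then: (1) $C_3$ complies with the policy: $\pi_{\{u,w\}}\circ\llbracket C_3\rrbracket\circ\hat g:\sigma(v_0)\Rightarrow\mathrm{Id}$ for every mediator family $g$ legal for $\sigma$; (2) $C_3$ is accepted by deferred specialisation: $\alpha_\sigma(\Delta_{C_3}(u)\otimes\Delta_{C_3}(w))\sqsubseteq\sigma(v_0)$; (3) every sound independent-attribute mechanism rejects $C_3$, whatever its rules and whatever universal object it specialises from: if the mechanism assigns to $C_3$ an environment $\Gamma':\mathit{Var}\to M$ that is sound for $\sigma$ and $C_3$, then its certified bound satisfies $\Gamma'(u)\otimes\Gamma'(w)\not\sqsubseteq\sigma(v_0)$.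
   Context: Quantale of information. $D$ is finite. $\mathrm{LoI}(D)$ is the set of equivalence relations on $D$ ordered by $P\sqsubseteq Q$ iff $Q\subseteq P$, so $P\sqcup Q=P\cap Q$, the least element $\mathrm{All}$ is the total relation and the greatest, $\mathrm{Id}$, is equality. For $\mathbb P\subseteq\mathrm{LoI}(D)$, $\mathrm{mix}(\mathbb P)$ is the set of equivalence relations each of whose cells is a cell of some member of $\mathbb P$, and $\mathrm{tc}(\mathbb P)={\downarrow}\mathrm{mix}(\mathbb P)$. $\mathrm{QoI}(D)$ is the set of $\mathbb P$ with $\mathrm{tc}(\mathbb P)=\mathbb P$, ordered by inclusion (written $\sqsubseteq$), with $\bigvee_i\mathbb P_i=\mathrm{tc}(\bigcup_i\mathbb P_i)$, $\mathbb P\otimes\mathbb Q=\mathrm{tc}\{P\sqcup Q\mid P\in\mathbb P,Q\in\mathbb Q\}$, unit $1=\{\mathrm{All}\}$; it is a commutative complete quantale. $M_1=\{m\mid 1\sqsubseteq m\}$ (the nonempty elements). Empty tensors are $1$. Language. $\mathit{Var}$ is finite; stores are maps $\mathit{Var}\to\mathit{Val}$. $\mathit{Val}$ contains an encoding (injective image) of every quotient $D/P$, $P\in\mathrm{LoI}(D)$, and supports injective pairing. $\llbracket C_3\rrbracket$ is the evident (total) store transformer of the two assignments. $\pi_W$ restricts a store to $W$. Mediators. For a partial function $h$ on $D$ and $\mathbb P\in\mathrm{QoI}(D)$, $h:\mathbb P\Rightarrow\mathrm{Id}$ means: some $P\in\mathbb P$ satisfies $h(d)=h(d')$ whenever $d\,P\,d'$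 and both are defined. A mediator family is $g=\langle g_v:D\rightharpoonup\mathit{Val}\rangle_{v\in\mathit{Var}}$ of partial functions with a common domain; $\hat g(d)$ is the store with $v$-component $g_v(d)$. $g$ is legal for $\sigma$ when $g_v:\sigma(v)\Rightarrow\mathrm{Id}$ for every $v$. A policy is a triple $(\sigma,W,\mathit{Pol})$ with $\sigma:\mathit{Var}\to M_1$, $W\subseteq\mathit{Var}$, $\mathit{Pol}\in M_1$; $C$ complies with it when $\pi_W\circ\llbracket C\rrbracket\circ\hat g:\mathit{Pol}\Rightarrow\mathrm{Id}$ for every legal $g$. Independent-attribute mechanisms. Such a mechanism assigns, for given $\sigma$ and $C$, one element $\Gamma'(v)$ of $M$ to each variable $v$, and certifies for each $W\subseteq\mathit{Var}$ the bound $\bigotimes_{w\in W}\Gamma'(w)$. It is sound (for $\sigma$, $C$) if $\pi_W\circ\llbracket C\rrbracket\circ\hat g:\bigotimes_{w\in W}\Gamma'(w)\Rightarrow\mathrm{Id}$ for every $g$ legal for $\sigma$ and every $W\subseteq\mathit{Var}$. A mechanism accepts $C$ for a policy $(\sigma,W,\mathit{Pol})$ when the certified bound for $W$ is $\sqsubseteq\mathit{Pol}$, and rejects otherwise. Set object. $\mathcal U$ is the set of downsets of $(\mathcal P(\mathit{Var}),\subseteq)$ ordered by inclusion, with $\bigvee=\bigcup$, $\mathbb X\otimes\mathbb Y={\downarrow}\{X\cup Y\mid X\in\mathbb X,Y\in\mathbb Y\}$, $1={\downarrow}\emptyset$; generators $\hat v={\downarrow}\{v\}$. $\alpha_\sigma(\mathbb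 X)=\bigvee_{X\in\mathbb X}\bigotimes_{v\in X}\sigma(v)$. Universal typing in $\mathcal U$ starts from $\Delta_0(v)=\hat v$ with context $1$; an assignment $x:=E$ sends $\Gamma$ to $\Gamma[x\mapsto\bigotimes_{v\in\mathit{fv}(E)}\Gamma(v)]$, where $\mathit{fv}(E)$ is the set of variables of $E$, and sequencing composes; $\Delta_{C_3}$ is the resulting environment. The deferred-specialisation mechanism certifies for $W$ the bound $\alpha_\sigma(\bigotimes_{w\in W}\Delta_C(w))$.
   Formalization: Part (3) is proved under the additional assumption that σ(v₀) ≠ ⊤; if σ(v₀) = ⊤ it fails, since Γ'(v) = ⊤ for all v is sound and its bound is ⊑ σ(v₀). *)

theory Defs
  imports "HOL-Library.FuncSet" "HOL-Algebra.FiniteProduct"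
begin

section \<open>The quantale of information\<close>

text \<open>
  The lattice of information on \<open>D\<close> is ordered by reverse inclusion: \<open>P\<close> lies below \<open>Q\<close> iff
  \<open>Q \<subseteq> P\<close>.  Hence the join of \<open>P\<close> and \<open>Q\<close> is \<open>P \<inter> Q\<close>, the least element is \<open>D \<times> D\<close> and the
  greatest is \<open>Id_on D\<close>.
\<close>

definition LoI :: "'d set \<Rightarrow> 'd rel set" where
  "LoI D = {P. equiv D P}"

definition mix :: "'d set \<Rightarrow> 'd rel set \<Rightarrow> 'd rel set" where
  "mix D PP = {R \<in> LoI D. \<forall>c \<in> D // R. \<exists>P \<in> PP. c \<in> D // P}"

definition tc :: "'d set \<Rightarrow> 'd rel set \<Rightarrow> 'd rel set" where
  "tc D PP = {R \<in> LoI D. \<exists>Q \<in> mix D PP. Q \<subseteq> R}"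

text \<open>
  The order of the quantale is \<open>\<subseteq>\<close>.  The tensor and its unit are packaged as a monoid record, so
  that finite tensors are instances of \<^const>\<open>finprod\<close> (the empty one being the unit).
\<close>

definition QoI :: "'d set \<Rightarrow> 'd rel set monoid" where
  "QoI D = \<lparr>carrier = {PP. PP \<subseteq> LoI D \<and> tc D PP = PP},
            monoid.mult = (\<lambda>PP QQ. tc D {P \<inter> Q | P Q. P \<in> PP \<and> Q \<in> QQ}),
            one = {D \<times> D}\<rparr>"

definition qoi_Sup :: "'d set \<Rightarrow> 'd rel set set \<Rightarrow> 'd rel set" where
  "qoi_Sup D A = tc D (\<Union>A)"

definition qoi_top :: "'d set \<Rightarrow> 'd rel set" where
  "qoi_top D = (GREATEST m. m \<in> carrier (QoI D))"

definition M1 :: "'d set \<Rightarrow> 'd rel set set" where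
  "M1 D = {m \<in> carrier (QoI D). \<one>\<^bsub>QoI D\<^esub> \<subseteq> m}"

definition saturated :: "'d set \<Rightarrow> 'd rel set \<Rightarrow> bool" where
  "saturated D m \<longleftrightarrow> m \<otimes>\<^bsub>QoI D\<^esub> m = qoi_top D"


section \<open>Straight-line programs\<close>

datatype ('var, 'val) expr =
    V 'var
  | Op "'val list \<Rightarrow> 'val" "('var, 'val) expr list"

datatype ('var, 'val) com =
    Assign 'var "('var, 'val) expr"
  | Seq "('var, 'val) com" "('var, 'val) com"

type_synonym ('var, 'val) store = "'var \<Rightarrow> 'val"

fun eval_expr :: "('var, 'val) expr \<Rightarrow> ('var, 'val) store \<Rightarrow> 'val" where
  "eval_expr (V x) s = s x"
| "eval_expr (Op f es) s = f (map (\<lambda>e. eval_expr e s) es)"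

fun fv :: "('var, 'val) expr \<Rightarrow> 'var set" where
  "fv (V x) = {x}"
| "fv (Op f es) = (\<Union>e \<in> set es. fv e)"

fun sem :: "('var, 'val) com \<Rightarrow> ('var, 'val) store \<Rightarrow> ('var, 'val) store" where
  "sem (Assign x E) s = s(x := eval_expr E s)"
| "sem (Seq c1 c2) s = sem c2 (sem c1 s)"


section \<open>Mediators, policies and compliance\<close>

text \<open>\<open>flows h m\<close> is the judgement \<open>h : m \<Rightarrow> Id\<close> for a partial function \<open>h\<close>.\<close>

definition flows :: "('d \<rightharpoonup> 'a) \<Rightarrow> 'd rel set \<Rightarrow> bool" where
  "flows h m \<longleftrightarrow> (\<exists>P \<in> m. \<forall>d d'. (d, d') \<in> P \<and> d \<in> dom h \<and> d' \<in> dom h \<longrightarrow> h d = h d')"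

definition mediator_family :: "'d set \<Rightarrow> ('var \<Rightarrow> 'd \<rightharpoonup> 'val) \<Rightarrow> bool" where
  "mediator_family D g \<longleftrightarrow> (\<exists>A \<subseteq> D. \<forall>v. dom (g v) = A)"

definition legal :: "'d set \<Rightarrow> ('var \<Rightarrow> 'd rel set) \<Rightarrow> ('var \<Rightarrow> 'd \<rightharpoonup> 'val) \<Rightarrow> bool" where
  "legal D \<sigma> g \<longleftrightarrow> mediator_family D g \<and> (\<forall>v. flows (g v) (\<sigma> v))"

definition hat :: "('var \<Rightarrow> 'd \<rightharpoonup> 'val) \<Rightarrow> 'd \<rightharpoonup> ('var, 'val) store" where
  "hat g d = (if \<forall>v. d \<in> dom (g v) then Some (\<lambda>v. the (g v d)) else None)"

definition observe ::
    "'var set \<Rightarrow> ('var, 'val) com \<Rightarrow> ('var \<Rightarrow> 'd \<rightharpoonup> 'val) \<Rightarrow> 'd \<rightharpoonup> ('var \<Rightarrow> 'val)" where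
  "observe W C g = map_option (\<lambda>s. restrict (sem C s) W) \<circ> hat g"

type_synonym ('var, 'd) policy = "('var \<Rightarrow> 'd rel set) \<times> 'var set \<times> 'd rel set"

fun complies :: "'d set \<Rightarrow> ('var, 'd) policy \<Rightarrow> ('var, 'val) com \<Rightarrow> bool" where
  "complies D (\<sigma>, W, Pol) C \<longleftrightarrow>
     (\<forall>g :: 'var \<Rightarrow> 'd \<rightharpoonup> 'val. legal D \<sigma> g \<longrightarrow> flows (observe W C g) Pol)"


section \<open>Mechanisms\<close>

text \<open>A mechanism enters through the bound \<open>b W\<close> it certifies for each set \<open>W\<close> of variables.\<close>

fun accepts :: "('var set \<Rightarrow> 'd rel set) \<Rightarrow> ('var, 'd) policy \<Rightarrow> bool" where
  "accepts b (\<sigma>, W, Pol) \<longleftrightarrow> b W \<subseteq> Pol"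

definition ia_bound :: "'d set \<Rightarrow> ('var \<Rightarrow> 'd rel set) \<Rightarrow> 'var set \<Rightarrow> 'd rel set" where
  "ia_bound D \<Gamma> W = (\<Otimes>\<^bsub>QoI D\<^esub>w\<in>W. \<Gamma> w)"

definition ia_sound ::
    "'d set \<Rightarrow> ('var \<Rightarrow> 'd rel set) \<Rightarrow> ('var, 'val) com \<Rightarrow> ('var \<Rightarrow> 'd rel set) \<Rightarrow> bool" where
  "ia_sound D \<sigma> C \<Gamma> \<longleftrightarrow>
     (\<forall>(g :: 'var \<Rightarrow> 'd \<rightharpoonup> 'val) W. legal D \<sigma> g \<longrightarrow> flows (observe W C g) (ia_bound D \<Gamma> W))"


section \<open>The set object and deferred specialisation\<close>

definition down :: "'var set set \<Rightarrow> 'var set set" where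
  "down XX = {Z. \<exists>X \<in> XX. Z \<subseteq> X}"

definition SetObj :: "'var set set monoid" where
  "SetObj = \<lparr>carrier = {XX. down XX = XX},
             monoid.mult = (\<lambda>XX YY. down {X \<union> Y | X Y. X \<in> XX \<and> Y \<in> YY}),
             one = down {{}}\<rparr>"

definition gen :: "'var \<Rightarrow> 'var set set" where
  "gen v = down {{v}}"

definition alpha :: "'d set \<Rightarrow> ('var \<Rightarrow> 'd rel set) \<Rightarrow> 'var set set \<Rightarrow> 'd rel set" where
  "alpha D \<sigma> XX = qoi_Sup D {\<Otimes>\<^bsub>QoI D\<^esub>v\<in>X. \<sigma> v | X. X \<in> XX}"

text \<open>
  Typing over an arbitrary commutative monoid.  Straight-line code is always typed in the unit
  context, so no context argument is needed.
\<close>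

fun typing :: "('a, 'b) monoid_scheme \<Rightarrow> ('var, 'val) com \<Rightarrow> ('var \<Rightarrow> 'a) \<Rightarrow> 'var \<Rightarrow> 'a" where
  "typing G (Assign x E) \<Gamma> = \<Gamma>(x := \<Otimes>\<^bsub>G\<^esub>v\<in>fv E. \<Gamma> v)"
| "typing G (Seq c1 c2) \<Gamma> = typing G c2 (typing G c1 \<Gamma>)"

definition univ_env :: "('var, 'val) com \<Rightarrow> 'var \<Rightarrow> 'var set set" where
  "univ_env C = typing SetObj C gen"

definition deferred_bound ::
    "'d set \<Rightarrow> ('var \<Rightarrow> 'd rel set) \<Rightarrow> ('var, 'val) com \<Rightarrow> 'var set \<Rightarrow> 'd rel set" where
  "deferred_bound D \<sigma> C W = alpha D \<sigma> (\<Otimes>\<^bsub>SetObj\<^esub>w\<in>W. univ_env C w)"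

end

theory Submission
  imports Defs
begin

text \<open>
  A sound independent-attribute environment must give both \<open>u\<close> and \<open>w\<close> a bound above \<open>\<sigma> v0\<close>, because
  for each \<open>P \<in> \<sigma> v0\<close> the mediator encoding the quotient map of \<open>P\<close> at \<open>v0\<close>, and constant elsewhere,
  is legal and is observed at \<open>u\<close> and at \<open>w\<close> separately.  Independence then forgets that the two
  variables carry the same value: the certified bound lies above \<open>\<sigma> v0 \<otimes> \<sigma> v0 = \<top>\<close>.  The set object
  remembers the common origin, since its tensor is idempotent on generators.
\<close>

section \<open>The closure \<open>tc\<close>\<close>

abbreviation intersections :: "'d rel set \<Rightarrow> 'd rel set \<Rightarrow> 'd rel set" where
  "intersections A B \<equiv> {P \<inter> Q | P Q. P \<in> A \<and> Q \<in> B}"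

lemma full_in_LoI: "D \<times> D \<in> LoI D"
  by (auto simp: LoI_def equiv_def refl_on_def sym_def trans_def)

lemma Int_in_LoI: "P \<in> LoI D \<Longrightarrow> Q \<in> LoI D \<Longrightarrow> P \<inter> Q \<in> LoI D"
  unfolding LoI_def equiv_def refl_on_def sym_def trans_def by blast

lemma intersections_LoI: "A \<subseteq> LoI D \<Longrightarrow> B \<subseteq> LoI D \<Longrightarrow> intersections A B \<subseteq> LoI D"
  using Int_in_LoI by blast

text \<open>As a union of images the family is flattened by image rewriting, which reduces
  associativity to that of \<open>\<inter>\<close>.\<close>

lemma intersections_UN: "intersections A B = (\<Union>P\<in>A. (\<inter>) P ` B)"
  by blast

lemma intersections_assoc:
  "intersections (intersections A B) C = intersections A (intersections B C)"
  unfolding intersections_UN by (auto simp: image_UN image_image Int_assoc)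

text \<open>A cell of \<open>P\<close> equal to the \<open>R\<close>-class of \<open>x\<close>
  contains \<open>x\<close>, so it can only be the \<open>P\<close>-class of \<open>x\<close>. Being
  a mixture thus becomes a condition checked point by point.\<close>

lemma mix_iff:
  assumes "A \<subseteq> LoI D"
  shows "R \<in> mix D A \<longleftrightarrow> R \<in> LoI D \<and> (\<forall>x \<in> D. \<exists>P \<in> A. P `` {x} = R `` {x})"
proof -
  have "R `` {x} \<in> D // P \<longleftrightarrow> P `` {x} = R `` {x}"
    if R: "R \<in> LoI D" and P: "P \<in> A" and x: "x \<in> D" for P x
  proof
    have eP: "equiv D P" and eR: "equiv D R"
      using R P assms by (auto simp: LoI_def)
    assume "R `` {x} \<in> D // P"
    then obtain y where y: "R `` {x} = P `` {y}" by (auto elim: quotientE)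
    have "x \<in> P `` {y}" using equiv_class_self[OF eR x] y by simp
    then show "P `` {x} = R `` {x}" using equiv_class_eq[OF eP] y by auto
  next
    assume "P `` {x} = R `` {x}"
    then show "R `` {x} \<in> D // P" using quotientI[OF x, of P] by simp
  qed
  then have "(\<forall>x \<in> D. \<exists>P \<in> A. R `` {x} \<in> D // P) \<longleftrightarrow> (\<forall>x \<in> D. \<exists>P \<in> A. P `` {x} = R `` {x})"
    if "R \<in> LoI D"
    using that by (intro ball_cong bex_cong refl) simp
  moreover have "(\<forall>c \<in> D // R. \<exists>P \<in> A. c \<in> D // P) \<longleftrightarrow> (\<forall>x \<in> D. \<exists>P \<in> A. R `` {x} \<in> D // P)"
    by (simp add: quotient_def[of D R])
  ultimately show ?thesis by (auto simp: mix_def)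
qed

lemma tcI: "Q \<in> mix D A \<Longrightarrow> Q \<subseteq> R \<Longrightarrow> R \<in> LoI D \<Longrightarrow> R \<in> tc D A"
  unfolding tc_def by blast

lemma tcE:
  assumes "R \<in> tc D A"
  obtains Q where "R \<in> LoI D" "Q \<in> mix D A" "Q \<subseteq> R"
  using assms unfolding tc_def by blast

lemma tc_subset_LoI: "tc D A \<subseteq> LoI D"
  by (auto simp: tc_def)

lemma subset_mix: "A \<subseteq> LoI D \<Longrightarrow> A \<subseteq> mix D A"
  by (auto simp: mix_iff)

lemma subset_tc: "A \<subseteq> LoI D \<Longrightarrow> A \<subseteq> tc D A"
  using subset_mix[of A D] by (auto simp: tc_def)

lemma mix_mono: "A \<subseteq> B \<Longrightarrow> mix D A \<subseteq> mix D B"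
  unfolding mix_def by blast

lemma tc_mono: "A \<subseteq> B \<Longrightarrow> tc D A \<subseteq> tc D B"
  using mix_mono[of A B D] by (auto simp: tc_def)

lemma tc_upward: "P \<in> tc D A \<Longrightarrow> R \<in> LoI D \<Longrightarrow> P \<subseteq> R \<Longrightarrow> R \<in> tc D A"
  unfolding tc_def by blast

text \<open>
  A mixture of coarsenings is a coarsening of a mixture: refine each cell separately, by the mixture
  whose coarsening it came from.
\<close>

lemma mix_tc_subset:
  assumes A: "A \<subseteq> LoI D"
  shows "mix D (tc D A) \<subseteq> tc D A"
proof
  fix R assume "R \<in> mix D (tc D A)"
  then have R: "R \<in> LoI D" and cells: "\<forall>c \<in> D // R. \<exists>P \<in> tc D A. c \<in> D // P"
    by (auto simp: mix_def)
  then have eR: "equiv D R" by (simp add: LoI_def)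
  \<comment> \<open>The cell \<open>c\<close> is a cell of some coarsening \<open>P\<close> of a
    mixture \<open>Q\<close>; since \<open>Q\<close> refines \<open>P\<close>, its classes starting
    in \<open>c\<close> stay in \<open>c\<close>.\<close>
  have "\<exists>Q \<in> mix D A. \<forall>y \<in> c. Q `` {y} \<subseteq> c" if "c \<in> D // R" for c
  proof -
    from bspec[OF cells that] obtain P where P: "P \<in> tc D A" and c: "c \<in> D // P" ..
    from P obtain Q where Q: "Q \<in> mix D A" "Q \<subseteq> P" by (rule tcE)
    have eP: "equiv D P" using P by (simp add: tc_def LoI_def)
    have "Q `` {y} \<subseteq> c" if "y \<in> c" for y
      using in_quotient_imp_closed[OF eP c that] Q(2) by auto
    with Q(1) show ?thesis by blast
  qed
  then obtain f where f: "\<And>c. c \<in> D // R \<Longrightarrow> f c \<in> mix D A"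
    and f_cell: "\<And>c y. c \<in> D // R \<Longrightarrow> y \<in> c \<Longrightarrow> f c `` {y} \<subseteq> c"
    by metis
  \<comment> \<open>Each point uses the mixture chosen for its own \<open>R\<close>-cell. The guard
    \<open>y \<in> D\<close> matters: outside \<open>D\<close> the \<open>R\<close>-class is empty,
    hence no cell, and \<open>f\<close> is unconstrained there.\<close>
  define R' where "R' = {(y, z). y \<in> D \<and> (y, z) \<in> f (R `` {y})}"
  have cls: "R `` {y} \<in> D // R" if "y \<in> D" for y
    using that by (rule quotientI)
  have ef: "equiv D (f (R `` {y}))" if "y \<in> D" for y
    using f[OF cls[OF that]] by (simp add: mix_def LoI_def)
  have R'R: "R' \<subseteq> R"
    using f_cell[OF cls] equiv_class_self[OF eR] by (fastforce simp: R'_def)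
  have R'_class: "R' `` {y} = f (R `` {y}) `` {y}" if "y \<in> D" for y
    using that by (auto simp: R'_def)
  \<comment> \<open>Points related by \<open>R'\<close> lie in one \<open>R\<close>-cell and so use
    the same mixture; symmetry and transitivity are inherited from that single equivalence.\<close>
  have same: "R `` {y} = R `` {z}" if "(y, z) \<in> R'" for y z
    using that R'R equiv_class_eq[OF eR] by blast
  have D': "y \<in> D \<and> z \<in> D" if "(y, z) \<in> R'" for y z
    using that R'R eR by (auto simp: equiv_def refl_on_def)
  have "equiv D R'"
  proof (rule equivI)
    show "R' \<subseteq> D \<times> D" using D' by auto
    show "refl_on D R'"
      using ef by (auto simp: refl_on_def R'_def equiv_def)
    show "sym R'"
    proof (rule symI)
      fix y z assume yz: "(y, z) \<in> R'"
      then have "(z, y) \<in> f (R `` {y})"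
        using ef[of y] by (auto simp: R'_def equiv_def dest: symD)
      then show "(z, y) \<in> R'" using same[OF yz] D'[OF yz] by (simp add: R'_def)
    qed
    show "trans R'"
    proof (rule transI)
      fix x y z assume xy: "(x, y) \<in> R'" and yz: "(y, z) \<in> R'"
      have "(y, z) \<in> f (R `` {x})" using yz same[OF xy] by (simp add: R'_def)
      then show "(x, z) \<in> R'"
        using xy ef[of x] by (auto simp: R'_def equiv_def dest: transD)
    qed
  qed
  moreover have "\<exists>P \<in> A. P `` {y} = R' `` {y}" if "y \<in> D" for y
    using f[OF cls[OF that]] that by (simp add: R'_class mix_iff[OF A])
  ultimately have "R' \<in> mix D A"
    by (simp add: mix_iff[OF A] LoI_def)
  then show "R \<in> tc D A" using R'R R by (rule tcI)
qed

text \<open>A mixture from \<open>A\<close> is a mixture from \<open>tc D B\<close>, which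
  \<open>mix_tc_subset\<close> puts back into \<open>tc D B\<close>; upward closure absorbs the
  final coarsening. Inclusions between closures then need checking on generators only.\<close>

lemma tc_least:
  assumes "A \<subseteq> tc D B" and "B \<subseteq> LoI D"
  shows "tc D A \<subseteq> tc D B"
proof
  fix R assume "R \<in> tc D A"
  then obtain Q where "R \<in> LoI D" "Q \<in> mix D A" "Q \<subseteq> R" by (rule tcE)
  then show "R \<in> tc D B"
    using mix_mono[OF assms(1)] mix_tc_subset[OF assms(2)] tc_upward by blast
qed

lemma tc_idem: "A \<subseteq> LoI D \<Longrightarrow> tc D (tc D A) = tc D A"
  using tc_least[of "tc D A" D A] subset_tc[OF tc_subset_LoI[of D A]] by blast

text \<open>The class of an intersection at a point is the intersection of the classes there, so
  generators matching two mixtures at that point intersect in one matching the intersection of the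
  mixtures. Associativity of the tensor rests on this.\<close>

lemma intersections_tc:
  assumes A: "A \<subseteq> LoI D" and B: "B \<subseteq> LoI D"
  shows "tc D (intersections (tc D A) (tc D B)) = tc D (intersections A B)"
proof
  show "tc D (intersections A B) \<subseteq> tc D (intersections (tc D A) (tc D B))"
    using subset_tc[OF A] subset_tc[OF B] by (intro tc_mono) blast
  have "P \<inter> Q \<in> tc D (intersections A B)" if P: "P \<in> tc D A" and Q: "Q \<in> tc D B" for P Q
  proof -
    obtain P' where P': "P' \<in> mix D A" "P' \<subseteq> P" using P by (rule tcE)
    obtain Q' where Q': "Q' \<in> mix D B" "Q' \<subseteq> Q" using Q by (rule tcE)
    have "\<exists>S \<in> intersections A B. S `` {x} = (P' \<inter> Q') `` {x}" if x: "x \<in> D" for x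
    proof -
      obtain P1 Q1 where "P1 \<in> A" "P1 `` {x} = P' `` {x}" "Q1 \<in> B" "Q1 `` {x} = Q' `` {x}"
        using P'(1) Q'(1) x unfolding mix_iff[OF A] mix_iff[OF B] by blast
      then show ?thesis by (intro bexI[of _ "P1 \<inter> Q1"]) auto
    qed
    then have "P' \<inter> Q' \<in> mix D (intersections A B)"
      using P'(1) Q'(1) unfolding mix_iff[OF intersections_LoI[OF A B]] mix_iff[OF A] mix_iff[OF B]
      by (blast intro: Int_in_LoI)
    moreover have "P \<inter> Q \<in> LoI D"
      using P Q by (simp add: tc_def Int_in_LoI)
    ultimately show ?thesis by (rule tcI[OF _ Int_mono[OF P'(2) Q'(2)]])
  qed
  then show "tc D (intersections (tc D A) (tc D B)) \<subseteq> tc D (intersections A B)"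
    by (intro tc_least[OF _ intersections_LoI[OF A B]]) blast
qed


section \<open>The two monoids\<close>

lemma carrier_QoI: "A \<in> carrier (QoI D) \<longleftrightarrow> A \<subseteq> LoI D \<and> tc D A = A"
  by (simp add: QoI_def)

lemma mult_QoI: "A \<otimes>\<^bsub>QoI D\<^esub> B = tc D (intersections A B)"
  by (simp add: QoI_def)

lemma one_QoI: "\<one>\<^bsub>QoI D\<^esub> = {D \<times> D}"
  by (simp add: QoI_def)

lemma carrier_QoI_upward:
  "A \<in> carrier (QoI D) \<Longrightarrow> P \<in> A \<Longrightarrow> R \<in> LoI D \<Longrightarrow> P \<subseteq> R \<Longrightarrow> R \<in> A"
  using tc_upward[of P D A R] by (simp add: carrier_QoI)

text \<open>Every class of a mixture drawn from \<open>{D \<times> D}\<close> is all of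
  \<open>D\<close>, and the total relation has no proper coarsening.\<close>

lemma tc_full: "tc D {D \<times> D} = {D \<times> D}"
proof
  have full: "{D \<times> D} \<subseteq> LoI D" by (simp add: full_in_LoI)
  then show "{D \<times> D} \<subseteq> tc D {D \<times> D}" by (rule subset_tc)
  show "tc D {D \<times> D} \<subseteq> {D \<times> D}"
  proof
    fix R assume "R \<in> tc D {D \<times> D}"
    then obtain Q where R: "equiv D R" and Q: "Q \<in> mix D {D \<times> D}" "Q \<subseteq> R"
      by (auto simp: tc_def LoI_def)
    have "Q `` {x} = D" if "x \<in> D" for x
      using Q(1) that by (auto simp: mix_iff[OF full])
    then have "D \<times> D \<subseteq> R" using Q(2) by blast
    then show "R \<in> {D \<times> D}" using R by (auto simp: equiv_def refl_on_def)
  qed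
qed

lemma comm_monoid_QoI: "comm_monoid (QoI D)"
proof (rule comm_monoidI)
  fix A B assume A: "A \<in> carrier (QoI D)" and B: "B \<in> carrier (QoI D)"
  then have AB: "intersections A B \<subseteq> LoI D"
    by (intro intersections_LoI) (auto simp: carrier_QoI)
  then show "A \<otimes>\<^bsub>QoI D\<^esub> B \<in> carrier (QoI D)"
    by (simp add: carrier_QoI mult_QoI tc_subset_LoI tc_idem)
  have "intersections A B = intersections B A" by blast
  then show "A \<otimes>\<^bsub>QoI D\<^esub> B = B \<otimes>\<^bsub>QoI D\<^esub> A" by (simp only: mult_QoI)
  fix C assume C: "C \<in> carrier (QoI D)"
  then have BC: "intersections B C \<subseteq> LoI D"
    using B by (intro intersections_LoI) (auto simp: carrier_QoI)
  \<comment> \<open>As \<open>C\<close> equals its own closure, \<open>intersections_tc\<close>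
    removes the inner closure; the mirror step uses that \<open>A\<close> is closed.\<close>
  have "tc D (intersections (tc D (intersections A B)) C) = tc D (intersections (intersections A B) C)"
    using intersections_tc[OF AB, of C] C by (simp add: carrier_QoI)
  also have "\<dots> = tc D (intersections A (intersections B C))"
    by (simp only: intersections_assoc)
  also have "\<dots> = tc D (intersections A (tc D (intersections B C)))"
    using intersections_tc[OF _ BC, of A] A by (simp add: carrier_QoI)
  finally show "A \<otimes>\<^bsub>QoI D\<^esub> B \<otimes>\<^bsub>QoI D\<^esub> C = A \<otimes>\<^bsub>QoI D\<^esub> (B \<otimes>\<^bsub>QoI D\<^esub> C)"
    by (simp only: mult_QoI)
next
  show "\<one>\<^bsub>QoI D\<^esub> \<in> carrier (QoI D)"
    by (simp add: carrier_QoI one_QoI full_in_LoI tc_full)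
next
  fix A assume A: "A \<in> carrier (QoI D)"
  then have "D \<times> D \<inter> P = P" if "P \<in> A" for P
    using that by (auto simp: carrier_QoI LoI_def equiv_def refl_on_def)
  then have "intersections {D \<times> D} A = A"
    unfolding intersections_UN by simp
  then show "\<one>\<^bsub>QoI D\<^esub> \<otimes>\<^bsub>QoI D\<^esub> A = A"
    using A by (simp only: one_QoI mult_QoI carrier_QoI)
qed

interpretation QoI: comm_monoid "QoI D" for D
  by (rule comm_monoid_QoI)

text \<open>The greatest element exists because \<open>LoI D\<close> is itself closed and contains
  every carrier element.\<close>

lemma qoi_top_eq: "qoi_top D = LoI D"
  unfolding qoi_top_def
proof (rule Greatest_equality)
  show "LoI D \<in> carrier (QoI D)"
    using subset_tc[of "LoI D" D] tc_subset_LoI[of D "LoI D"] by (auto simp: carrier_QoI)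
qed (simp add: carrier_QoI)

lemma mult_QoI_mono: "A \<subseteq> A' \<Longrightarrow> B \<subseteq> B' \<Longrightarrow> A \<otimes>\<^bsub>QoI D\<^esub> B \<subseteq> A' \<otimes>\<^bsub>QoI D\<^esub> B'"
  unfolding mult_QoI by (rule tc_mono) blast

section \<open>Downsets of sets of variables, and their specialisation\<close>

lemma down_idem: "down (down X) = down X"
  unfolding down_def by blast

lemma comm_monoid_SetObj: "comm_monoid SetObj"
proof -
  \<comment> \<open>With the downset closure unfolded to covering by a union, associativity only
    requires enlarging the intermediate set \<open>T\<close> to the union that covers it.\<close>
  have mult: "Z \<in> A \<otimes>\<^bsub>SetObj\<^esub> B \<longleftrightarrow> (\<exists>X \<in> A. \<exists>Y \<in> B. Z \<subseteq> X \<union> Y)" for A B :: "'a set set" and Z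
    unfolding SetObj_def down_def by auto
  have assoc: "(A \<otimes>\<^bsub>SetObj\<^esub> B) \<otimes>\<^bsub>SetObj\<^esub> C = A \<otimes>\<^bsub>SetObj\<^esub> (B \<otimes>\<^bsub>SetObj\<^esub> C)"
    (is "?L = ?R") for A B C :: "'a set set"
  proof
    show "?L \<subseteq> ?R"
    proof
      fix Z assume "Z \<in> ?L"
      then obtain T X Y W where T: "X \<in> A" "Y \<in> B" "W \<in> C" "T \<subseteq> X \<union> Y" "Z \<subseteq> T \<union> W"
        by (auto simp: mult)
      then have "Y \<union> W \<in> B \<otimes>\<^bsub>SetObj\<^esub> C" "Z \<subseteq> X \<union> (Y \<union> W)" by (auto simp: mult)
      with T show "Z \<in> ?R" unfolding mult[of Z] by blast
    qed
    show "?R \<subseteq> ?L"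
    proof
      fix Z assume "Z \<in> ?R"
      then obtain T X Y W where T: "X \<in> A" "Y \<in> B" "W \<in> C" "T \<subseteq> Y \<union> W" "Z \<subseteq> X \<union> T"
        by (auto simp: mult)
      then have "X \<union> Y \<in> A \<otimes>\<^bsub>SetObj\<^esub> B" "Z \<subseteq> X \<union> Y \<union> W" by (auto simp: mult)
      with T show "Z \<in> ?L" unfolding mult[of Z] by blast
    qed
  qed
  have one: "\<one>\<^bsub>SetObj\<^esub> = {{} :: 'a set}"
    by (auto simp: SetObj_def down_def)
  show ?thesis
  proof (rule comm_monoidI)
    fix A B :: "'a set set"
    show "A \<otimes>\<^bsub>SetObj\<^esub> B \<in> carrier SetObj"
      by (simp add: SetObj_def down_idem)
    show "A \<otimes>\<^bsub>SetObj\<^esub> B = B \<otimes>\<^bsub>SetObj\<^esub> A"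
      by (rule Set.set_eqI, unfold mult) (metis Un_commute)
  next
    show "\<one>\<^bsub>SetObj\<^esub> \<in> carrier (SetObj :: 'a set set monoid)"
      by (simp add: SetObj_def down_idem)
  next
    fix A :: "'a set set" assume "A \<in> carrier SetObj"
    then have A: "Z \<in> A \<longleftrightarrow> (\<exists>X \<in> A. Z \<subseteq> X)" for Z
      unfolding SetObj_def down_def by auto
    show "\<one>\<^bsub>SetObj\<^esub> \<otimes>\<^bsub>SetObj\<^esub> A = A"
    proof (rule Set.set_eqI)
      fix Z
      have "Z \<in> \<one>\<^bsub>SetObj\<^esub> \<otimes>\<^bsub>SetObj\<^esub> A \<longleftrightarrow> (\<exists>X \<in> A. Z \<subseteq> X)"
        by (simp add: mult one)
      also have "\<dots> \<longleftrightarrow> Z \<in> A" by (rule A[symmetric])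
      finally show "Z \<in> \<one>\<^bsub>SetObj\<^esub> \<otimes>\<^bsub>SetObj\<^esub> A \<longleftrightarrow> Z \<in> A" .
    qed
  qed (rule assoc)
qed

interpretation SetObj: comm_monoid SetObj
  by (rule comm_monoid_SetObj)

lemma gen_eq: "gen v = {{}, {v}}"
  by (auto simp: gen_def down_def)

lemma gen_closed: "gen v \<in> carrier SetObj"
  by (simp add: gen_def SetObj_def down_idem)

text \<open>The subsets of \<open>{v}\<close> are closed under union, so using one variable twice
  costs nothing here, whereas in the quantale \<open>\<sigma> v\<close> tensored with itself may
  grow.\<close>

lemma gen_mult_self: "gen v \<otimes>\<^bsub>SetObj\<^esub> gen v = gen v"
  unfolding gen_eq by (auto simp: SetObj_def down_def)

text \<open>The tensors over \<open>{}\<close> and \<open>{v}\<close> are the unit and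
  \<open>\<sigma> v\<close>. Membership in \<open>M1\<close> lets \<open>\<sigma> v\<close> absorb
  the unit, and closedness absorbs the outer \<open>tc\<close>.\<close>

lemma alpha_gen:
  assumes "\<sigma> v \<in> M1 D"
  shows "alpha D \<sigma> (gen v) = \<sigma> v"
proof -
  have v: "\<sigma> v \<in> carrier (QoI D)" "\<one>\<^bsub>QoI D\<^esub> \<subseteq> \<sigma> v" using assms by (auto simp: M1_def)
  then have "{\<Otimes>\<^bsub>QoI D\<^esub>x\<in>X. \<sigma> x | X. X \<in> gen v} = {\<one>\<^bsub>QoI D\<^esub>, \<sigma> v}"
    by (auto simp: gen_eq intro: exI[of _ "{}"] exI[of _ "{v}"])
  then show ?thesis
    using v by (simp add: alpha_def qoi_Sup_def carrier_QoI Un_absorb1)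
qed


section \<open>Flows through the two copies\<close>

text \<open>The relation witnessing the flow of \<open>h\<close> serves \<open>k\<close> as well,
  because on its domain \<open>k\<close> factors through \<open>h\<close>.\<close>

lemma flows_mono_kernel:
  assumes "flows h m" and "dom k \<subseteq> dom h"
    and "\<And>d d'. d \<in> dom k \<Longrightarrow> d' \<in> dom k \<Longrightarrow> h d = h d' \<Longrightarrow> k d = k d'"
  shows "flows k m"
proof -
  obtain P where P: "P \<in> m"
    and eq: "\<And>d d'. (d, d') \<in> P \<Longrightarrow> d \<in> dom h \<Longrightarrow> d' \<in> dom h \<Longrightarrow> h d = h d'"
    using assms(1) unfolding flows_def by blast
  have "k d = k d'" if "(d, d') \<in> P" "d \<in> dom k" "d' \<in> dom k" for d d'
    using that assms(2) by (intro assms(3) eq) auto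
  then show ?thesis using P unfolding flows_def by blast
qed

text \<open>Totality of the function on \<open>D\<close> places the whole witness \<open>Q\<close>
  inside the kernel of \<open>f\<close>, hence inside \<open>P\<close>; upward closure of
  \<open>m\<close> then yields \<open>P\<close>. This turns a soundness judgement into a
  membership.\<close>

lemma total_flow:
  assumes "flows (\<lambda>d. if d \<in> D then Some (f d) else None) m" and "m \<in> carrier (QoI D)"
    and "P \<in> LoI D" and "\<And>d d'. d \<in> D \<Longrightarrow> d' \<in> D \<Longrightarrow> f d = f d' \<Longrightarrow> (d, d') \<in> P"
  shows "P \<in> m"
proof -
  obtain Q where Q: "Q \<in> m" and eq: "\<And>d d'. (d, d') \<in> Q \<Longrightarrow> d \<in> D \<Longrightarrow> d' \<in> D \<Longrightarrow> f d = f d'"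
    using assms(1) by (fastforce simp: flows_def dom_def)
  have "Q \<subseteq> D \<times> D" using Q assms(2) by (auto simp: carrier_QoI LoI_def equiv_def refl_on_def)
  then have "Q \<subseteq> P" using eq assms(4) by blast
  then show ?thesis using carrier_QoI_upward[OF assms(2) Q assms(3)] by blast
qed

lemma sem_copies:
  "u \<noteq> v0 \<Longrightarrow> w \<noteq> v0 \<Longrightarrow> x \<in> {u, w} \<Longrightarrow> sem (Seq (Assign u (V v0)) (Assign w (V v0))) s x = s v0"
  by auto

text \<open>Soundness is tested at the singleton \<open>{x}\<close>, where the certified bound is
  \<open>\<Gamma> x\<close> alone, with a mediator whose observation has kernel exactly
  \<open>P\<close> on \<open>D\<close>.\<close>

lemma ia_sound_copy_ge:
  fixes C :: "('var, 'val) com"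
  assumes val_quotients: "\<And>P. P \<in> LoI D \<Longrightarrow> \<exists>enc :: 'd set \<Rightarrow> 'val. inj_on enc (D // P)"
    and sigma: "\<And>v. \<sigma> v \<in> M1 D"
    and copy: "\<And>s. sem C s x = s v0"
    and Gamma: "\<Gamma> x \<in> carrier (QoI D)"
    and sound: "ia_sound D \<sigma> C \<Gamma>"
  shows "\<sigma> v0 \<subseteq> \<Gamma> x"
proof
  fix P assume P: "P \<in> \<sigma> v0"
  then have LoI: "P \<in> LoI D" using sigma[of v0] by (auto simp: M1_def carrier_QoI)
  then have eP: "equiv D P" by (simp add: LoI_def)
  obtain enc :: "'d set \<Rightarrow> 'val" where enc: "inj_on enc (D // P)" using val_quotients[OF LoI] by blast
  \<comment> \<open>Defined on all of \<open>D\<close> so that \<open>total_flow\<close> applies.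
    Injectivity of \<open>enc\<close> on the cells lets the value at \<open>v0\<close> determine the
    \<open>P\<close>-class; the other components carry one arbitrary value.\<close>
  define g :: "'var \<Rightarrow> 'd \<rightharpoonup> 'val" where
    "g v d = (if d \<in> D then Some (if v = v0 then enc (P `` {d}) else undefined) else None)" for v d
  have dom_g: "dom (g v) = D" for v by (auto simp: g_def dom_def)
  have "flows (g v) (\<sigma> v)" for v
  proof (cases "v = v0")
    case True
    then show ?thesis
      unfolding flows_def dom_g
      by (intro bexI[of _ P]) (auto simp: g_def P equiv_class_eq[OF eP])
  next
    case False
    \<comment> \<open>A constant component is legal through the total relation, which every element
      of \<open>M1\<close> contains.\<close>
    moreover have "D \<times> D \<in> \<sigma> v" using sigma[of v] by (simp add: M1_def one_QoI)
    ultimately show ?thesis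
      unfolding flows_def dom_g by (intro bexI[of _ "D \<times> D"]) (auto simp: g_def)
  qed
  then have "legal D \<sigma> g" using dom_g by (auto simp: legal_def mediator_family_def)
  then have "flows (observe {x} C g) (ia_bound D \<Gamma> {x})"
    using sound by (simp add: ia_sound_def)
  moreover have "ia_bound D \<Gamma> {x} = \<Gamma> x" using Gamma by (simp add: ia_bound_def)
  moreover have "observe {x} C g =
      (\<lambda>d. if d \<in> D then Some (restrict (\<lambda>_. enc (P `` {d})) {x}) else None)"
    by (rule ext) (auto simp: observe_def hat_def dom_g g_def restrict_def copy)
  ultimately have flow:
      "flows (\<lambda>d. if d \<in> D then Some (restrict (\<lambda>_. enc (P `` {d})) {x}) else None) (\<Gamma> x)"
    by simp
  show "P \<in> \<Gamma> x"
  proof (rule total_flow[OF flow Gamma LoI])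
    fix d d' assume d: "d \<in> D" "d' \<in> D"
      and "restrict (\<lambda>_. enc (P `` {d})) {x} = restrict (\<lambda>_. enc (P `` {d'})) {x}"
    then have "enc (P `` {d}) = enc (P `` {d'})" by (metis restrict_apply singletonI)
    then have "P `` {d} = P `` {d'}" using enc d by (auto dest: inj_onD intro: quotientI)
    then show "(d, d') \<in> P" using eq_equiv_class[OF _ eP d(2)] by simp
  qed
qed

text \<open>The guard \<open>\<sigma> v0 \<noteq> qoi_top D\<close> on rejection excludes the
  degenerate case: the top element is saturated and lies above every certified bound, so nothing is
  rejected against it.\<close>

theorem theorem8:
  fixes D :: "'d set"
    and \<sigma> :: "'var::finite \<Rightarrow> 'd rel set"
    and u w v0 :: 'var
    and C3 :: "('var, 'val) com"
  assumes "finite D"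
    and val_quotients: "\<And>P. P \<in> LoI D \<Longrightarrow> \<exists>enc :: 'd set \<Rightarrow> 'val. inj_on enc (D // P)"
    and val_pairing: "\<exists>pair :: 'val \<times> 'val \<Rightarrow> 'val. inj pair"
    and sigma: "\<And>v. \<sigma> v \<in> M1 D"
    and distinct: "u \<noteq> w" "u \<noteq> v0" "w \<noteq> v0"
    and sat: "saturated D (\<sigma> v0)"
    and C3: "C3 = Seq (Assign u (V v0)) (Assign w (V v0))"
  shows "complies D (\<sigma>, {u, w}, \<sigma> v0) C3
    \<and> (alpha D \<sigma> (univ_env C3 u \<otimes>\<^bsub>SetObj\<^esub> univ_env C3 w) \<subseteq> \<sigma> v0
       \<and> accepts (deferred_bound D \<sigma> C3) (\<sigma>, {u, w}, \<sigma> v0))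
    \<and> (\<sigma> v0 \<noteq> qoi_top D \<longrightarrow>
       (\<forall>\<Gamma>'. (\<forall>v. \<Gamma>' v \<in> carrier (QoI D)) \<and> ia_sound D \<sigma> C3 \<Gamma>' \<longrightarrow>
          \<not> (\<Gamma>' u \<otimes>\<^bsub>QoI D\<^esub> \<Gamma>' w \<subseteq> \<sigma> v0)
          \<and> \<not> accepts (ia_bound D \<Gamma>') (\<sigma>, {u, w}, \<sigma> v0)))"
proof -
  have copy: "sem C3 s x = s v0" if "x \<in> {u, w}" for s x
    using that distinct sem_copies unfolding C3 by metis
  have "flows (observe {u, w} C3 g) (\<sigma> v0)" if "legal D \<sigma> g" for g :: "'var \<Rightarrow> 'd \<rightharpoonup> 'val"
  proof (rule flows_mono_kernel)
    show "flows (g v0) (\<sigma> v0)" using that by (simp add: legal_def)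
    \<comment> \<open>Both observed variables hold the value of \<open>g v0\<close>, so the joint
      observation depends on that value alone and a single flow of \<open>g v0\<close> covers the
      pair.\<close>
    have obs: "observe {u, w} C3 g d =
        (if \<forall>v. d \<in> dom (g v) then Some (\<lambda>x\<in>{u, w}. the (g v0 d)) else None)" for d
      by (auto simp: observe_def hat_def copy intro!: restrict_ext)
    show "dom (observe {u, w} C3 g) \<subseteq> dom (g v0)"
    proof
      fix d assume "d \<in> dom (observe {u, w} C3 g)"
      then show "d \<in> dom (g v0)" using obs[of d] by (auto split: if_splits)
    qed
    fix d d' assume "d \<in> dom (observe {u, w} C3 g)" "d' \<in> dom (observe {u, w} C3 g)" "g v0 d = g v0 d'"
    then show "observe {u, w} C3 g d = observe {u, w} C3 g d'"
      using obs[of d] obs[of d'] by (metis domIff)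
  qed
  then have 1: "complies D (\<sigma>, {u, w}, \<sigma> v0) C3" by simp

  \<comment> \<open>Each right-hand side is the single variable \<open>v0\<close>, whose entry is
    still \<open>gen v0\<close> at the second assignment because
    \<open>u \<noteq> v0\<close>.\<close>
  have env: "univ_env C3 u = gen v0" "univ_env C3 w = gen v0"
    using distinct by (simp_all add: C3 univ_env_def gen_closed)
  then have a: "alpha D \<sigma> (univ_env C3 u \<otimes>\<^bsub>SetObj\<^esub> univ_env C3 w) = \<sigma> v0"
    by (simp add: gen_mult_self alpha_gen sigma)
  have "(\<Otimes>\<^bsub>SetObj\<^esub>x\<in>{u, w}. univ_env C3 x) = univ_env C3 u \<otimes>\<^bsub>SetObj\<^esub> univ_env C3 w"
    using distinct env by (simp add: gen_closed)
  then have 2: "accepts (deferred_bound D \<sigma> C3) (\<sigma>, {u, w}, \<sigma> v0)"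
    using a by (simp add: deferred_bound_def)

  have 3: "\<not> (\<Gamma>' u \<otimes>\<^bsub>QoI D\<^esub> \<Gamma>' w \<subseteq> \<sigma> v0) \<and> \<not> accepts (ia_bound D \<Gamma>') (\<sigma>, {u, w}, \<sigma> v0)"
    if proper: "\<sigma> v0 \<noteq> qoi_top D" and Gamma: "\<And>v. \<Gamma>' v \<in> carrier (QoI D)"
      and sound: "ia_sound D \<sigma> C3 \<Gamma>'" for \<Gamma>'
  proof -
    \<comment> \<open>The two variables are bounded separately, possibly by different relations of
      \<open>\<sigma> v0\<close>; monotonicity of the tensor then combines the bounds and saturation
      lifts the result to the top.\<close>
    have "\<sigma> v0 \<subseteq> \<Gamma>' x" if "x \<in> {u, w}" for x
      by (rule ia_sound_copy_ge[where C = C3, OF val_quotients sigma copy[OF that] Gamma sound])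
    then have "\<sigma> v0 \<otimes>\<^bsub>QoI D\<^esub> \<sigma> v0 \<subseteq> \<Gamma>' u \<otimes>\<^bsub>QoI D\<^esub> \<Gamma>' w"
      by (intro mult_QoI_mono) auto
    then have top: "qoi_top D \<subseteq> \<Gamma>' u \<otimes>\<^bsub>QoI D\<^esub> \<Gamma>' w"
      using sat by (simp add: saturated_def)
    have "\<sigma> v0 \<subseteq> qoi_top D"
      using sigma[of v0] by (simp add: qoi_top_eq M1_def carrier_QoI)
    then have not: "\<not> (\<Gamma>' u \<otimes>\<^bsub>QoI D\<^esub> \<Gamma>' w \<subseteq> \<sigma> v0)"
      using top proper by blast
    moreover have "ia_bound D \<Gamma>' {u, w} = \<Gamma>' u \<otimes>\<^bsub>QoI D\<^esub> \<Gamma>' w"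
      using distinct Gamma by (simp add: ia_bound_def)
    ultimately show ?thesis by simp
  qed
  show ?thesis using 1 2 3 a by blast
qed

end
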